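(* Let $V \geq 1$ and $d \geq 0$ be fixed integers. Then for every integer $n \geq 1$ with $$n \geq 4d \binom{2d+V-1}{2d},$$ every $n$-dimensional lattice polytope $\Delta \subset \mathbb{R}^n$ with $\mathrm{Vol}_{\mathbb{N}}(\Delta) = V$ and $\deg \Delta = d$ is a pyramid $\Pi(\Delta')$ over some $(n-1)$-dimensional lattice polytope $\Delta' \subset \mathbb{R}^{n-1}$.
   Context: A lattice polytope $\Delta \subset \mathbb{R}^n$ is a convex polytope all of whose vertices lie in $\mathbb{Z}^n$. For an $n$-dimensional lattice polytope $\Delta\subset\mathbb{R}^n$ ($n \ge 1$), the normalized volume is $\mathrm{Vol}_{\mathbb{N}}(\Delta) := n!\,\mathrm{vol}(\Delta)$, where $\mathrm{vol}$ is the Euclidean volume; the codegree is $\mathrm{codeg}\,\Delta := \min\{k \in \mathbb{Z}_{\geq 0} : \mathrm{Int}(k\Delta)\cap \mathbb{Z}^n \neq \emptyset\}$, where $\mathrm{Int}$ is the interior; the degree is $\deg\Delta := n+1-\mathrm{codeg}\,\Delta \in \mathbb{Z}_{\ge 0}$. For an $m$-dimensional lattice polytope $\Delta' \subset \mathbb{R}^m$ ($m\ge 0$), the standard pyramid of height $1$ over $\Delta'$ is $\Pi(\Delta') := \mathrm{conv}\big((\Delta'\times\{0\}) \cup \{(0,\dots,0,1)\}\big) \subset \mathbb{R}^{m+1}$. The statement "$\Delta$ is a pyramid $\Pi(\Delta')$" is understood up to the action on $\mathbb{R}^n$ of the group $AGL(n,\mathbb{Z})$ of invertible affine integral transformations,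 i.e. $\Delta$ is $AGL(n,\mathbb{Z})$-equivalent to $\Pi(\Delta')$. *)

theory Defs
  imports "HOL-Analysis.Analysis"
begin

definition integer_lattice :: "(real ^ 'n) set" where
  "integer_lattice = {x. \<forall>i. x $ i \<in> \<int>}"

definition lattice_polytope :: "(real ^ 'n) set \<Rightarrow> bool" where
  "lattice_polytope P \<longleftrightarrow>
     polytope P \<and> (\<forall>v. v extreme_point_of P \<longrightarrow> v \<in> integer_lattice)"

definition normalized_volume :: "(real ^ 'n) set \<Rightarrow> real" where
  "normalized_volume P = fact CARD('n) * measure lebesgue P"

definition codegree :: "(real ^ 'n) set \<Rightarrow> nat" where
  "codegree P = (LEAST k. interior ((\<lambda>x. real k *\<^sub>R x) ` P) \<inter> integer_lattice \<noteq> {})"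

definition lattice_degree :: "(real ^ 'n) set \<Rightarrow> int" where
  "lattice_degree P = int CARD('n) + 1 - int (codegree P)"

definition GL_int :: "(real ^ 'n ^ 'n) set" where
  "GL_int = {A. (\<forall>i j. A $ i $ j \<in> \<int>) \<and>
     (\<exists>B. (\<forall>i j. B $ i $ j \<in> \<int>) \<and> A ** B = mat 1 \<and> B ** A = mat 1)}"

definition AGL_int :: "(real ^ 'n \<Rightarrow> real ^ 'n) set" where
  "AGL_int = {f. \<exists>A\<in>GL_int. \<exists>b\<in>integer_lattice. \<forall>x. f x = A *v x + b}"

definition AGL_equivalent :: "(real ^ 'n) set \<Rightarrow> (real ^ 'n) set \<Rightarrow> bool" where
  "AGL_equivalent P Q \<longleftrightarrow> (\<exists>f\<in>AGL_int. f ` P = Q)"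

text \<open>
  The type \<^typ>\<open>real ^ 'n\<close> has dimension at least 1, whereas the base of a pyramid over a point
  lives in a space of dimension 0. With the coordinate \<open>l\<close> in the role of the last one,
  \<open>R^(n-1)\<close> is therefore represented by its copy \<open>R^(n-1) \<times> {0}\<close>, the hyperplane of vectors
  whose \<open>l\<close>-th coordinate vanishes (a single point if \<open>n = 1\<close>); its lattice points are the
  points of \<^const>\<open>integer_lattice\<close> in it. A set \<open>Q\<close> in this hyperplane stands for
  \<open>\<Delta>' \<times> {0}\<close>, and the apex \<open>(0, \<dots>, 0, 1)\<close> is the \<open>l\<close>-th unit vector.
\<close>

definition coordinate_hyperplane :: "'n \<Rightarrow> (real ^ 'n) set" where
  "coordinate_hyperplane l = {x. x $ l = 0}"

definition standard_pyramid :: "'n \<Rightarrow> (real ^ 'n) set \<Rightarrow> (real ^ 'n) set" where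
  "standard_pyramid l Q = convex hull (Q \<union> {axis l 1})"

end

theory Submission
  imports Defs
begin

text \<open>
  Choose \<open>n + 1\<close> affinely independent vertices \<open>S\<close> of \<open>\<Delta>\<close>, and let \<open>W\<close> be the set of the other
  vertices. Adding a vertex to a lattice polytope adds a lattice simplex beyond some facet, so
  \<open>card W \<le> V - 1\<close>. As \<open>k \<Delta>\<close> has no interior lattice point for \<open>k \<le> n - d\<close>, every vertex in \<open>W\<close> has
  at most \<open>2 d + 1\<close> nonzero barycentric coordinates with respect to \<open>S\<close>, and every point of
  \<open>\<int>\<^sup>n \<times> \<int>\<close> has at most \<open>2 d\<close> non-integral coordinates in the basis \<open>S \<times> {1}\<close>. By averaging over subset sums, all
  but at most \<open>4 d\<close> of the coordinates are integral on the whole lattice. Hence, if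
  \<open>n \<ge> 4 d + (2 d + 1) card W\<close>, some coordinate is integral on the lattice and vanishes on all vertices
  except one, and this vertex is the apex of a pyramid.
\<close>

subsection \<open>Completing primitive vectors to unimodular matrices\<close>

lemma integer_latticeI [intro]: "(\<And>i. x $ i \<in> \<int>) \<Longrightarrow> x \<in> integer_lattice"
  and integer_latticeD: "x \<in> integer_lattice \<Longrightarrow> x $ i \<in> \<int>"
  by (auto simp: integer_lattice_def)

lemma integer_lattice_add: "x \<in> integer_lattice \<Longrightarrow> y \<in> integer_lattice \<Longrightarrow> x + y \<in> integer_lattice"
  and integer_lattice_diff: "x \<in> integer_lattice \<Longrightarrow> y \<in> integer_lattice \<Longrightarrow> x - y \<in> integer_lattice"
  and integer_lattice_scale: "r \<in> \<int> \<Longrightarrow> x \<in> integer_lattice \<Longrightarrow> r *\<^sub>R x \<in> integer_lattice"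
  and integer_lattice_zero: "0 \<in> integer_lattice"
  and integer_lattice_axis: "axis i 1 \<in> integer_lattice"
  by (auto simp: integer_lattice_def axis_def)

lemma integer_lattice_sum: "(\<And>a. a \<in> A \<Longrightarrow> f a \<in> integer_lattice) \<Longrightarrow> sum f A \<in> integer_lattice"
  by (induction A rule: infinite_finite_induct) (auto simp: integer_lattice_zero integer_lattice_add)

definition int_matrix :: "real ^ 'n ^ 'n \<Rightarrow> bool" where
  "int_matrix A \<longleftrightarrow> (\<forall>i j. A $ i $ j \<in> \<int>)"

lemma int_matrix_mult: "int_matrix A \<Longrightarrow> int_matrix B \<Longrightarrow> int_matrix (A ** B)"
  by (auto simp: int_matrix_def matrix_matrix_mult_def intro!: Ints_sum Ints_mult)

lemma int_matrix_vector_mult: "int_matrix A \<Longrightarrow> x \<in> integer_lattice \<Longrightarrow> A *v x \<in> integer_lattice"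
  by (auto simp: int_matrix_def integer_lattice_def matrix_vector_mult_def intro!: Ints_sum Ints_mult)

lemma GL_int_iff:
  "A \<in> GL_int \<longleftrightarrow> int_matrix A \<and> (\<exists>B. int_matrix B \<and> A ** B = mat 1 \<and> B ** A = mat 1)"
  by (simp add: GL_int_def int_matrix_def)

lemma GL_int_inverse:
  assumes "A \<in> GL_int"
  obtains B where "B \<in> GL_int" "A ** B = mat 1" "B ** A = mat 1"
  using assms unfolding GL_int_iff by blast

lemma GL_int_mult:
  assumes "A \<in> GL_int" "B \<in> GL_int"
  shows "A ** B \<in> GL_int"
proof -
  obtain A' B' where "int_matrix A'" "A ** A' = mat 1" "A' ** A = mat 1"
    "int_matrix B'" "B ** B' = mat 1" "B' ** B = mat 1"
    using assms unfolding GL_int_iff by blast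
  moreover from this have "(A ** B) ** (B' ** A') = mat 1" "(B' ** A') ** (A ** B) = mat 1"
    by (metis matrix_mul_assoc matrix_mul_rid)+
  ultimately show ?thesis
    using assms unfolding GL_int_iff by (blast intro: int_matrix_mult)
qed

lemma GL_int_transpose:
  fixes A :: "real ^ 'n ^ 'n::finite"
  assumes "A \<in> GL_int"
  shows "transpose A \<in> GL_int"
proof -
  obtain B where "int_matrix B" "A ** B = mat 1" "B ** A = mat 1"
    using assms unfolding GL_int_iff by blast
  moreover from this have "transpose A ** transpose B = mat 1" "transpose B ** transpose A = mat 1"
    by (simp_all add: matrix_transpose_mul[symmetric] transpose_mat)
  moreover have "int_matrix (transpose C)" if "int_matrix C" for C :: "real^'n^'n"
    using that by (simp add: int_matrix_def transpose_def)
  ultimately show ?thesis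
    using assms unfolding GL_int_iff by blast
qed

text \<open>The identity matrix with \<open>r\<close> added at position \<open>(i, j)\<close>. It is
  given as the matrix of a linear map so that identities between products reduce to the action on
  vectors.\<close>

definition transvection :: "'n \<Rightarrow> 'n \<Rightarrow> real \<Rightarrow> real ^ 'n ^ 'n::finite" where
  "transvection i j r = matrix (\<lambda>x. x + axis i (r * x $ j))"

lemma linear_transvection: "linear (\<lambda>x::real^'n. x + axis i (r * x $ j))"
  by (rule linearI) (auto simp: vec_eq_iff axis_def algebra_simps)

lemma transvection_apply: "transvection i j r *v x = x + axis i (r * x $ j)"
  unfolding transvection_def by (simp add: linear_transvection)

lemma transvection_inverse: "i \<noteq> j \<Longrightarrow> transvection i j r ** transvection i j (- r) = mat 1"
  by (subst matrix_eq)
     (auto simp: matrix_vector_mul_assoc[symmetric] transvection_apply vec_eq_iff axis_def)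

lemma transvection_GL_int:
  assumes "i \<noteq> j" "r \<in> \<int>"
  shows "transvection i j r \<in> GL_int"
proof -
  have "int_matrix (transvection i j r)" if "r \<in> \<int>" for r
    using that by (auto simp: int_matrix_def transvection_def matrix_def axis_def)
  then show ?thesis
    unfolding GL_int_iff using assms transvection_inverse[of i j r] transvection_inverse[of i j "-r"]
    by (metis Ints_minus minus_minus)
qed

text \<open>Serves the end of Euclid's algorithm, where a single entry 1 or -1 is left. Swapping two
  coordinates and multiplying by a sign is an involution, so its integral matrix is its own
  inverse.\<close>

lemma signed_swap_GL_int:
  fixes i l :: "'n::finite"
  assumes "s = 1 \<or> s = (-1::real)"
  shows "\<exists>A \<in> GL_int. A *v axis l 1 = axis i s"
proof -
  define f where "f = (\<lambda>x::real^'n. \<chi> k. s * x $ (Transposition.transpose i l k))"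
  have lin: "linear f"
    by (rule linearI) (auto simp: f_def vec_eq_iff algebra_simps)
  have ff: "f (f x) = x" for x
    using assms by (auto simp: f_def vec_eq_iff)
  have "matrix f ** matrix f = mat 1"
    by (subst matrix_eq) (simp add: matrix_vector_mul_assoc[symmetric] lin ff)
  moreover have "int_matrix (matrix f)"
    using assms by (auto simp: int_matrix_def matrix_def f_def axis_def)
  ultimately have "matrix f \<in> GL_int"
    unfolding GL_int_iff by blast
  moreover have "matrix f *v axis l 1 = axis i s"
  proof -
    have "matrix f *v axis l 1 = f (axis l 1)"
      by (simp add: lin)
    then show ?thesis
      by (auto simp: f_def vec_eq_iff axis_def Transposition.transpose_def)
  qed
  ultimately show ?thesis by blast
qed

text \<open>Euclid's algorithm: subtracting a smaller entry from a larger one lowers the \<open>\<ell>\<^sup>1\<close>-norm.\<close>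

lemma primitive_vector_in_GL_int_orbit:
  fixes a y :: "real ^ 'n::finite"
  assumes "a \<in> integer_lattice" "y \<in> integer_lattice" "a \<bullet> y = 1"
  shows "\<exists>A \<in> GL_int. A *v axis l 1 = a"
  using assms
proof (induction "nat \<lfloor>\<Sum>i\<in>UNIV. \<bar>a $ i\<bar>\<rfloor>" arbitrary: a y rule: less_induct)
  case less
  note a = integer_latticeD[OF less.prems(1)] and y = integer_latticeD[OF less.prems(2)]
  show ?case
  proof (cases "\<exists>i j. i \<noteq> j \<and> a $ j \<noteq> 0 \<and> \<bar>a $ j\<bar> \<le> \<bar>a $ i\<bar>")
    case True
    then obtain i j where ij: "i \<noteq> j" "a $ j \<noteq> 0" "\<bar>a $ j\<bar> \<le> \<bar>a $ i\<bar>" by blast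
    \<comment> \<open>This sign lowers the absolute value of entry \<open>i\<close> by that of entry
      \<open>j\<close>, which is at least 1 by integrality.\<close>
    define r where "r = - sgn (a $ i) * sgn (a $ j)"
    have r: "r \<in> \<int>"
      by (auto simp: r_def sgn_if)
    define a' where "a' = transvection i j r *v a"
    \<comment> \<open>\<open>y\<close> moves by the inverse transpose of the transvection, so the
      pairing with \<open>a\<close> keeps the value 1.\<close>
    define y' where "y' = transvection j i (- r) *v y"
    have a'y': "a' \<in> integer_lattice" "y' \<in> integer_lattice"
      using less.prems ij(1) r transvection_GL_int[of i j r] transvection_GL_int[of j i "-r"]
      unfolding a'_def y'_def by (auto simp: GL_int_iff intro!: int_matrix_vector_mult)
    have "a' \<bullet> y' = 1"
      using less.prems(3) ij(1)
      by (simp add: a'_def y'_def transvection_apply inner_add_left inner_add_right inner_axis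
          inner_axis') (simp add: axis_def)
    have a'_eq: "a' $ k = (if k = i then a $ i + r * a $ j else a $ k)" for k
      by (auto simp: a'_def transvection_apply axis_def)
    have "\<bar>a $ i + r * a $ j\<bar> = \<bar>a $ i\<bar> - \<bar>a $ j\<bar>"
      using ij by (auto simp: r_def sgn_if abs_if split: if_splits)
    then have "(\<Sum>k\<in>UNIV. \<bar>a' $ k\<bar>) = (\<Sum>k\<in>UNIV. \<bar>a $ k\<bar>) - \<bar>a $ j\<bar>"
      by (simp add: sum.remove[of UNIV i] a'_eq)
    moreover have "\<bar>a $ j\<bar> \<ge> 1"
      using Ints_nonzero_abs_ge1[OF a ij(2)] .
    moreover have "(\<Sum>k\<in>UNIV. \<bar>a' $ k\<bar>) \<ge> 0"
      by (simp add: sum_nonneg)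
    ultimately have "nat \<lfloor>\<Sum>k\<in>UNIV. \<bar>a' $ k\<bar>\<rfloor> < nat \<lfloor>\<Sum>k\<in>UNIV. \<bar>a $ k\<bar>\<rfloor>"
      by linarith
    from less.hyps[OF this a'y' \<open>a' \<bullet> y' = 1\<close>]
    obtain A where A: "A \<in> GL_int" "A *v axis l 1 = a'" by blast
    have "transvection i j (-r) ** A \<in> GL_int"
      using A(1) ij(1) r by (intro GL_int_mult transvection_GL_int) auto
    moreover have "(transvection i j (-r) ** A) *v axis l 1 = a"
      unfolding matrix_vector_mul_assoc[symmetric] A(2) a'_def
      using transvection_inverse[OF ij(1), of "- r"] by (simp add: matrix_vector_mul_assoc)
    ultimately show ?thesis by blast
  next
    case False
    \<comment> \<open>Two nonzero entries in different positions would allow another Euclidean step.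
      The only nonzero entry left is a unit of the integers because
      \<open>a \<bullet> y = 1\<close>.\<close>
    then have uniq: "i = j" if "a $ i \<noteq> 0" "a $ j \<noteq> 0" for i j
      using that linorder_linear[of "\<bar>a $ i\<bar>" "\<bar>a $ j\<bar>"] by metis
    obtain i where i: "a $ i \<noteq> 0"
      using less.prems(3) by (metis inner_zero_left vec_eq_iff zero_index zero_neq_one)
    have a_axis: "a = axis i (a $ i)"
      using uniq[OF i] by (auto simp: vec_eq_iff axis_def)
    then have "a $ i * y $ i = 1"
      using less.prems(3) by (metis inner_axis' inner_real_def)
    moreover obtain p q :: int where "a $ i = of_int p" "y $ i = of_int q"
      using a[of i] y[of i] by (auto elim!: Ints_cases)
    ultimately have "p * q = 1"
      by (metis of_int_eq_1_iff of_int_mult)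
    then have "a $ i = 1 \<or> a $ i = -1"
      using \<open>a $ i = of_int p\<close> zmult_eq_1_iff by force
    then show ?thesis
      using signed_swap_GL_int[of "a $ i" l i] a_axis by metis
  qed
qed

subsection \<open>Volumes of lattice polytopes\<close>

text \<open>The library computes volumes of simplices in \<open>real ^ 'n\<close> only for well-ordered \<open>'n\<close>;
  this type is a well-ordered copy of an arbitrary finite index type.\<close>

typedef ('a::finite) ordinal_index = "{..<CARD('a)}"
  by (auto intro: zero_less_card_finite)

instantiation ordinal_index :: (finite) wellorder
begin

definition less_eq_ordinal_index :: "'a ordinal_index \<Rightarrow> 'a ordinal_index \<Rightarrow> bool" where
  "x \<le> y \<longleftrightarrow> Rep_ordinal_index x \<le> Rep_ordinal_index y"

definition less_ordinal_index :: "'a ordinal_index \<Rightarrow> 'a ordinal_index \<Rightarrow> bool" where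
  "x < y \<longleftrightarrow> Rep_ordinal_index x < Rep_ordinal_index y"

instance
proof
  fix P :: "'a ordinal_index \<Rightarrow> bool" and a :: "'a ordinal_index"
  assume "\<And>x. (\<And>y. y < x \<Longrightarrow> P y) \<Longrightarrow> P x"
  then show "P a"
    unfolding less_ordinal_index_def by (rule measure_induct_rule)
qed (auto simp: less_eq_ordinal_index_def less_ordinal_index_def Rep_ordinal_index_inject)

end

lemma bij_betw_Rep_ordinal_index:
  "bij_betw (Rep_ordinal_index :: 'a ordinal_index \<Rightarrow> nat) UNIV {..<CARD('a::finite)}"
proof -
  interpret type_definition "Rep_ordinal_index :: 'a ordinal_index \<Rightarrow> nat" Abs_ordinal_index "{..<CARD('a)}"
    by (rule type_definition_ordinal_index)
  show ?thesis
    using Rep_range by (auto simp: bij_betw_def inj_def Rep_inject)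
qed

instance ordinal_index :: (finite) finite
  by standard (metis bij_betw_Rep_ordinal_index bij_betw_finite finite_lessThan)

lemma ex_bij_ordinal_index: "\<exists>g :: 'a::finite ordinal_index \<Rightarrow> 'a. bij g"
proof -
  have "CARD('a ordinal_index) = CARD('a)"
    using bij_betw_same_card[OF bij_betw_Rep_ordinal_index] by simp
  then show ?thesis
    by (auto intro: finite_same_card_bij)
qed

lemma prod_Basis_vec: "(\<Prod>b\<in>Basis. f b) = (\<Prod>i\<in>UNIV. f (axis i (1::real)))"
  by (simp add: Basis_vec_def UNION_singleton_eq_range prod.reindex inj_on_def axis_eq_axis)

text \<open>Lebesgue measure is determined by its values on boxes, and the preimage of a box under a
  renaming of coordinates is a box with the same side lengths.\<close>

lemma lborel_eq_distr_reindex: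
  fixes g :: "'m::finite \<Rightarrow> 'n::finite"
  assumes "bij g"
  shows "(lborel :: (real ^ 'm) measure) = distr lborel borel (\<lambda>x. \<chi> j. x $ g j)"
proof (rule lborel_eqI)
  have meas: "(\<lambda>x::real^'n. \<chi> j. x $ g j) \<in> borel_measurable borel"
    by (intro borel_measurable_continuous_onI continuous_intros)
  fix l u :: "real ^ 'm"
  assume lu: "\<And>b. b \<in> Basis \<Longrightarrow> l \<bullet> b \<le> u \<bullet> b"
  have lu': "l $ i \<le> u $ i" for i
    using lu[of "axis i 1"] by (auto simp: Basis_vec_def inner_axis)
  have inv: "inv g (g j) = j" "g (inv g i) = i" for i j
    using assms by (auto simp: bij_is_inj bij_is_surj surj_f_inv_f)
  have "(\<lambda>x::real^'n. \<chi> j. x $ g j) -` box l u = box (\<chi> i. l $ inv g i) (\<chi> i. u $ inv g i)"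
    by (auto simp: mem_box_cart inv) (metis inv)+
  then have "emeasure (distr lborel borel (\<lambda>x. \<chi> j. x $ g j)) (box l u) =
        emeasure lborel (box (\<chi> i. l $ inv g i) (\<chi> i. u $ inv g i))"
    using meas by (simp add: emeasure_distr)
  also have "\<dots> = (\<Prod>b\<in>Basis. ((\<chi> i. u $ inv g i) - (\<chi> i. l $ inv g i)) \<bullet> b)"
    using lu' by (intro emeasure_lborel_box) (auto simp: Basis_vec_def inner_axis)
  also have "\<dots> = ennreal (\<Prod>b\<in>Basis. (u - l) \<bullet> b)"
    using prod.reindex_bij_betw[OF assms, of "\<lambda>i. u $ inv g i - l $ inv g i"]
    by (simp add: prod_Basis_vec inner_axis inv)
  finally show "emeasure (distr lborel borel (\<lambda>x. \<chi> j. x $ g j)) (box l u) = (\<Prod>b\<in>Basis. (u - l) \<bullet> b)" .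
qed simp

lemma measure_reindex_image:
  fixes g :: "'m::finite \<Rightarrow> 'n::finite" and S :: "(real ^ 'n) set"
  assumes "bij g" "compact S"
  shows "measure lebesgue ((\<lambda>x. \<chi> j. x $ g j) ` S) = measure lebesgue S"
proof -
  let ?f = "\<lambda>x::real^'n. (\<chi> j. x $ g j) :: real^'m"
  have "continuous_on A ?f" for A
    by (intro continuous_intros)
  then have comp: "compact (?f ` S)" and meas: "?f \<in> borel_measurable borel"
    using assms(2) by (auto intro: compact_continuous_image borel_measurable_continuous_onI)
  have "inj ?f"
    using assms(1) by (auto simp: inj_def vec_eq_iff) (metis bij_pointE)
  then have vimage: "?f -` (?f ` S) = S"
    by (simp add: inj_vimage_image_eq)
  have "measure lborel (?f ` S) = measure (distr lborel borel ?f) (?f ` S)"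
    using lborel_eq_distr_reindex[OF assms(1)] by simp
  also have "\<dots> = measure lborel S"
    using comp meas by (subst measure_distr) (auto simp: vimage borel_compact)
  finally show ?thesis
    using assms(2) comp by (simp add: measure_completion borel_compact)
qed

section \<open>Volumes of lattice simplices\<close>

lemma det_in_Ints:
  fixes M :: "real ^ 'n::finite ^ 'n"
  assumes "\<And>i j. M $ i $ j \<in> \<int>"
  shows "det M \<in> \<int>"
  unfolding det_def using assms by (intro Ints_sum Ints_mult Ints_prod) auto

text \<open>The volume is \<open>\<bar>det M\<bar> / fact CARD('n)\<close> for the matrix
  \<open>M\<close> of edge vectors at one vertex, and a nonzero integer determinant has absolute
  value at least 1.\<close>

lemma lattice_simplex_volume_wellorder:
  fixes X :: "(real ^ 'n::{finite,wellorder}) set"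
  assumes "finite X" "card X = Suc CARD('n)" "X \<subseteq> integer_lattice"
    and "measure lebesgue (convex hull X) \<noteq> 0"
  shows "measure lebesgue (convex hull X) \<ge> 1 / fact CARD('n)"
proof -
  obtain x0 where x0: "x0 \<in> X"
    using assms(2) by fastforce
  have "card (UNIV :: 'n set) = card (X - {x0})"
    using assms(1,2) x0 by simp
  then obtain f where f: "bij_betw f (UNIV :: 'n set) (X - {x0})"
    using assms(1) finite_same_card_bij[of "UNIV :: 'n set" "X - {x0}"] by auto
  define M where "M = (\<chi> i. \<chi> j. f j $ i - x0 $ i)"
  have "compact (convex hull X)"
    using assms(1) by (rule finite_imp_compact_convex_hull)
  then have vol: "measure lebesgue (convex hull X) = \<bar>det M\<bar> / fact CARD('n)"
    using content_simplex[OF assms(1,2) x0 f] unfolding M_def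
    by (simp add: measure_completion borel_compact)
  have "f j \<in> integer_lattice" for j
    using bij_betwE[OF f] assms(3) by blast
  then have "det M \<in> \<int>"
    using x0 assms(3) by (intro det_in_Ints) (auto simp: M_def integer_lattice_def)
  moreover have "det M \<noteq> 0"
    using assms(4) vol by auto
  ultimately show ?thesis
    unfolding vol by (intro divide_right_mono Ints_nonzero_abs_ge1) auto
qed

text \<open>Affine independence gives nonempty interior, hence nonzero volume; renaming the
  coordinates by \<open>ordinal_index\<close> changes neither volume nor integrality.\<close>

lemma lattice_simplex_volume:
  fixes X :: "(real ^ 'n::finite) set"
  assumes "\<not> affine_dependent X" "card X = Suc CARD('n)" "X \<subseteq> integer_lattice"
  shows "measure lebesgue (convex hull X) \<ge> 1 / fact CARD('n)"
proof -
  obtain g :: "'n ordinal_index \<Rightarrow> 'n" where g: "bij g"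
    using ex_bij_ordinal_index by blast
  let ?f = "\<lambda>x::real^'n. \<chi> j. x $ g j"
  have fin: "finite X"
    using assms(2) card_ge_0_finite by force
  have card: "CARD('n ordinal_index) = CARD('n)"
    using bij_betw_same_card[OF g] .
  have "linear ?f"
    by (rule linearI) (auto simp: vec_eq_iff)
  have "inj ?f"
    using g by (auto simp: inj_def vec_eq_iff) (metis bij_pointE)
  have hull: "convex hull (?f ` X) = ?f ` (convex hull X)"
    by (rule convex_hull_linear_image[OF \<open>linear ?f\<close>, symmetric])
  have vol: "measure lebesgue (convex hull (?f ` X)) = measure lebesgue (convex hull X)"
    unfolding hull by (rule measure_reindex_image[OF g finite_imp_compact_convex_hull[OF fin]])
  have "interior (convex hull X) \<noteq> {}"
    using assms(1,2) interior_convex_hull_eq_empty[of X] by simp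
  moreover have lattice: "?f ` X \<subseteq> integer_lattice"
    using assms(3) by (auto simp: integer_lattice_def)
  ultimately have "measure lebesgue (convex hull X) \<noteq> 0"
    using negligible_convex_interior[OF convex_convex_hull, of X]
    by (simp add: negligible_iff_measure finite_imp_bounded_convex_hull[OF fin] measurable_convex)
  then show ?thesis
    using lattice_simplex_volume_wellorder[of "?f ` X"] fin assms(2) lattice vol card
    by (simp add: card_image[OF inj_on_subset[OF \<open>inj ?f\<close>]])
qed

text \<open>A segment from an interior point to \<open>w\<close> leaves the polytope through a
  facet. The point \<open>w\<close> and an affine basis of that facet span a lattice simplex that
  meets the polytope only in the hyperplane of the facet.\<close>

lemma lattice_volume_insert:
  fixes E :: "(real ^ 'n::finite) set"
  assumes fin: "finite E" and "E \<subseteq> integer_lattice" "w \<in> integer_lattice"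
    and dim: "aff_dim E = int CARD('n)" and w: "w \<notin> convex hull E"
  shows "measure lebesgue (convex hull E) + 1 / fact CARD('n) \<le> measure lebesgue (convex hull (insert w E))"
proof -
  define P where "P = convex hull E"
  have P: "compact P" "convex P" "polyhedron P"
    using fin by (auto simp: P_def finite_imp_compact_convex_hull intro!: polytope_imp_polyhedron polytope_convex_hull)
  have dimP: "aff_dim P = int CARD('n)"
    using dim by (simp add: P_def aff_dim_convex_hull)
  then have "affine hull P = UNIV" "P \<noteq> {}"
    by (auto simp: aff_dim_eq_full[symmetric])
  then have int: "interior P \<noteq> {}" "rel_interior P = interior P"
    using rel_interior_eq_empty[OF P(2)] by (auto simp: rel_interior_interior)
  then obtain c where c: "c \<in> interior P" by blast
  have "closed_segment c w \<inter> frontier P \<noteq> {}"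
    using c w interior_subset[of P] by (intro connected_Int_frontier) (auto simp: P_def)
  then obtain y where y: "y \<in> closed_segment c w" "y \<in> frontier P" by blast
  then have "y \<in> P - rel_interior P"
    using P(1) int by (simp add: frontier_def compact_imp_closed)
  then obtain F where F: "F facet_of P" "y \<in> F"
    using rel_boundary_of_polyhedron[OF P(3)] by blast
  then have "F exposed_face_of P"
    using exposed_face_of_polyhedron[OF P(3)] facet_of_imp_face_of by blast
  then obtain a b where ab: "P \<subseteq> {x. a \<bullet> x \<le> b}" "F = P \<inter> {x. a \<bullet> x = b}"
    unfolding exposed_face_of_def by blast
  have a0: "a \<noteq> 0"
  proof
    assume "a = 0"
    then have "F = P"
      using ab F(2) by auto
    then show False
      using F(1) by (simp add: facet_of_def)
  qed
  have "a \<bullet> c < b"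
    using c ab(1) interior_mono[OF ab(1)] interior_halfspace_le[OF a0, of b] by auto
  moreover obtain u where u: "0 \<le> u" "u \<le> 1" "y = (1 - u) *\<^sub>R c + u *\<^sub>R w"
    using y(1) by (auto simp: in_segment)
  moreover have "a \<bullet> y = b"
    using F(2) ab(2) by auto
  \<comment> \<open>On the segment the functional \<open>a\<close> rises from a value below
    \<open>b\<close> at \<open>c\<close> to \<open>b\<close> at \<open>y\<close>, and
    \<open>y\<close> differs from \<open>w\<close>; hence it exceeds \<open>b\<close> at
    \<open>w\<close>.\<close>
  ultimately have b: "b = (1 - u) * (a \<bullet> c) + u * (a \<bullet> w)"
    by (simp add: inner_add_right)
  then have "u * (a \<bullet> w - b) = (1 - u) * (b - a \<bullet> c)" "u \<noteq> 0"
    using \<open>a \<bullet> c < b\<close> by (auto simp: algebra_simps)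
  moreover have "u \<noteq> 1"
    using u(3) w \<open>y \<in> P - _\<close> by (auto simp: P_def)
  ultimately have "u * (a \<bullet> w - b) > 0" "u > 0"
    using u \<open>a \<bullet> c < b\<close> by auto
  then have aw: "a \<bullet> w > b"
    by (simp add: zero_less_mult_iff)
  \<comment> \<open>A face of a convex hull is the hull of some of the generators, so the facet
    contains \<open>CARD('n)\<close> affinely independent points of \<open>E\<close>.\<close>
  obtain E' where E': "E' \<subseteq> E" "F = convex hull E'"
    using face_of_convex_hull_subset[OF finite_imp_compact[OF fin]] facet_of_imp_face_of[OF F(1)]
    unfolding P_def by blast
  obtain B where B: "B \<subseteq> E'" "\<not> affine_dependent B" "affine hull E' = affine hull B"
    using affine_basis_exists by blast
  have "aff_dim E' = int CARD('n) - 1"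
    using F(1) dimP E'(2) by (simp add: facet_of_def aff_dim_convex_hull)
  then have cardB: "card B = CARD('n)"
    using aff_dim_unique[of B E'] B by simp
  have B_plane: "B \<subseteq> {x. a \<bullet> x = b}"
    using B(1) E'(2) ab(2) hull_subset[of E' convex] by auto
  then have "affine hull B \<subseteq> {x. a \<bullet> x = b}"
    by (intro hull_minimal affine_hyperplane)
  then have w_B: "w \<notin> affine hull B"
    using aw by auto
  define T where "T = convex hull (insert w B)"
  have "\<not> affine_dependent (insert w B)"
    using B(2) w_B affine_independent_insert by blast
  moreover have "card (insert w B) = Suc CARD('n)"
    using cardB w_B hull_inc[of w B affine] by (metis card_insert_disjoint aff_independent_finite B(2))
  ultimately have volT: "measure lebesgue T \<ge> 1 / fact CARD('n)"
    unfolding T_def using B(1) E'(1) assms(2,3) by (intro lattice_simplex_volume) auto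
  have "T \<subseteq> {x. a \<bullet> x \<ge> b}"
    unfolding T_def using B_plane aw by (intro hull_minimal convex_halfspace_ge) auto
  then have "P \<inter> T \<subseteq> {x. a \<bullet> x = b}"
    using ab(1) by force
  then have "negligible (P \<inter> T)"
    using negligible_hyperplane[of a b] a0 negligible_subset by blast
  then have null: "measure lebesgue (P \<inter> T) = 0"
    by (rule negligible_imp_measure0)
  have finB: "finite (insert w B)"
    using aff_independent_finite[OF B(2)] by simp
  have meas: "P \<in> lmeasurable" "T \<in> lmeasurable" "convex hull (insert w E) \<in> lmeasurable"
    using fin finB by (auto simp: P_def T_def intro!: lmeasurable_compact finite_imp_compact_convex_hull)
  have "P \<union> T \<subseteq> convex hull (insert w E)"
    unfolding P_def T_def using B(1) E'(1) by (intro Un_least hull_mono) auto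
  then have "measure lebesgue (P \<union> T) \<le> measure lebesgue (convex hull (insert w E))"
    using meas by (intro measure_mono_fmeasurable) auto
  then show ?thesis
    using measure_Un3[OF meas(1,2)] null volT by (simp add: P_def)
qed

text \<open>The points of \<open>W\<close> are added one by one. Hulls of fewer points are smaller,
  so each new point lies outside the hull of those already present and contributes the volume of a
  lattice simplex.\<close>

lemma convex_position_volume:
  fixes S W :: "(real ^ 'n::finite) set"
  assumes S: "\<not> affine_dependent S" "card S = Suc CARD('n)" "S \<subseteq> integer_lattice"
    and "finite W" "W \<subseteq> integer_lattice" "S \<inter> W = {}"
    and "\<And>w. w \<in> W \<Longrightarrow> w \<notin> convex hull (S \<union> W - {w})"
  shows "(real (card W) + 1) / fact CARD('n) \<le> measure lebesgue (convex hull (S \<union> W))"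
  using assms(4-)
proof (induction W rule: finite_induct)
  case empty
  then show ?case
    using lattice_simplex_volume[OF S] by simp
next
  case (insert w W)
  have finS: "finite S"
    using S(1) by (rule aff_independent_finite)
  have eq: "S \<union> insert w W - {w} = S \<union> W"
    using insert by auto
  have "v \<notin> convex hull (S \<union> W - {v})" if "v \<in> W" for v
  proof -
    have "convex hull (S \<union> W - {v}) \<subseteq> convex hull (S \<union> insert w W - {v})"
      by (rule hull_mono) auto
    then show ?thesis
      using insert.prems(3)[of v] that by blast
  qed
  then have IH: "(real (card W) + 1) / fact CARD('n) \<le> measure lebesgue (convex hull (S \<union> W))"
    using insert by (intro insert.IH) auto
  have "aff_dim S = int CARD('n)"
    using S(1,2) aff_dim_affine_independent[of S] by simp
  moreover have "aff_dim S \<le> aff_dim (S \<union> W)"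
    by (rule aff_dim_subset) simp
  ultimately have "aff_dim (S \<union> W) = int CARD('n)"
    using aff_dim_le_DIM[of "S \<union> W"] by simp
  moreover have "w \<notin> convex hull (S \<union> W)"
    using insert.prems(3)[of w] eq by simp
  ultimately have "measure lebesgue (convex hull (S \<union> W)) + 1 / fact CARD('n)
      \<le> measure lebesgue (convex hull (insert w (S \<union> W)))"
    using finS insert S(3) by (intro lattice_volume_insert) auto
  then show ?case
    using IH insert.hyps by (simp add: add_divide_distrib)
qed

subsection \<open>Barycentric coordinates and the degree\<close>

text \<open>Double counting of the pairs \<open>(u, T)\<close> with \<open>u \<in> h T\<close>: each
  \<open>u\<close> occurs for at least half of the subsets, so the average of
  \<open>card (h T \<inter> U)\<close> is at least half of \<open>card U\<close>.\<close>

lemma half_of_subsets_bound: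
  assumes "finite U"
    and half: "\<And>u T. u \<in> U \<Longrightarrow> T \<subseteq> U - {u} \<Longrightarrow> u \<in> h T \<or> u \<in> h (insert u T)"
    and bound: "\<And>T. T \<subseteq> U \<Longrightarrow> card (h T \<inter> U) \<le> k"
  shows "card U \<le> 2 * k"
proof (cases "U = {}")
  case False
  then obtain m where m: "card U = Suc m"
    using \<open>finite U\<close> by (metis card_eq_0_iff not0_implies_Suc)
  have "2 ^ m \<le> card {T \<in> Pow U. u \<in> h T}" if u: "u \<in> U" for u
  proof -
    \<comment> \<open>From each pair \<open>T\<close>, \<open>insert u T\<close> this selects a
      member whose image under \<open>h\<close> contains \<open>u\<close>.\<close>
    let ?f = "\<lambda>T. if u \<in> h T then T else insert u T"
    have "inj_on ?f (Pow (U - {u}))"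
      by (rule inj_onI) (auto split: if_splits)
    moreover have "?f ` Pow (U - {u}) \<subseteq> {T \<in> Pow U. u \<in> h T}"
      using u half[OF u] by auto
    ultimately have "card (Pow (U - {u})) \<le> card {T \<in> Pow U. u \<in> h T}"
      using \<open>finite U\<close> by (intro card_inj_on_le[of ?f]) auto
    then show ?thesis
      using u \<open>finite U\<close> m by (simp add: card_Pow)
  qed
  then have "card U * 2 ^ m \<le> (\<Sum>u\<in>U. card {T \<in> Pow U. u \<in> h T})"
    using sum_mono[of U "\<lambda>_. 2 ^ m" "\<lambda>u. card {T \<in> Pow U. u \<in> h T}"] by simp
  also have "\<dots> = (\<Sum>T\<in>Pow U. card {u \<in> U. u \<in> h T})"
    using \<open>finite U\<close> by (intro sum_multicount_gen) auto
  also have "\<dots> \<le> (\<Sum>T\<in>Pow U. k)"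
    using bound by (intro sum_mono) (auto simp: Int_def conj_commute)
  also have "\<dots> = 2 * k * 2 ^ m"
    using \<open>finite U\<close> by (simp add: card_Pow m)
  finally show ?thesis
    by simp
qed simp

text \<open>Supplies a perturbation so small that \<open>1 + e * f a\<close> and
  \<open>1 - e * f a\<close> stay positive.\<close>

lemma ex_small_epsilon:
  assumes "finite A"
  shows "\<exists>e>0. e < 1 \<and> (\<forall>a\<in>A. e * \<bar>f a\<bar> < (1::real))"
proof -
  define M where "M = 2 + (\<Sum>a\<in>A. \<bar>f a\<bar>)"
  have "M \<ge> 2"
    by (simp add: M_def sum_nonneg)
  moreover have "\<bar>f a\<bar> < M" if "a \<in> A" for a
    using member_le_sum[OF that, of "\<lambda>a. \<bar>f a\<bar>"] assms by (simp add: M_def)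
  ultimately show ?thesis
    by (intro exI[of _ "1 / M"]) auto
qed

text \<open>Affine independence of \<open>S\<close> is linear independence of the lifts
  \<open>(v, 1)\<close>; being as many as the dimension, they form a basis, and \<open>c\<close> is
  the dual basis.\<close>

lemma affine_coordinates_exist:
  fixes S :: "(real ^ 'n::finite) set"
  assumes "\<not> affine_dependent S" "card S = Suc CARD('n)"
  obtains c :: "real ^ 'n \<Rightarrow> (real ^ 'n) \<times> real \<Rightarrow> real" where "\<And>v. linear (c v)"
    "\<And>z. (\<Sum>v\<in>S. c v z *\<^sub>R (v, 1)) = z" "\<And>u v. u \<in> S \<Longrightarrow> c v (u, 1) = (if v = u then 1 else 0)"
proof -
  define B where "B = (\<lambda>v::real^'n. (v, 1::real)) ` S"
  have fin: "finite S"
    using assms(1) by (rule aff_independent_finite)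
  have inj: "inj_on (\<lambda>v. (v, 1::real)) S"
    by (auto simp: inj_on_def)
  have "\<forall>v\<in>S. g v = 0" if "(\<Sum>v\<in>S. g v *\<^sub>R (v, 1::real)) = 0" for g
  proof -
    have "(\<Sum>v\<in>S. g v *\<^sub>R v) = 0" "sum g S = 0"
      using arg_cong[OF that, of fst] arg_cong[OF that, of snd] by (simp_all add: fst_sum snd_sum)
    then show ?thesis
      using assms(1) affine_dependent_explicit_finite[OF fin] by auto
  qed
  note trivial = this
  have finB: "finite B"
    using fin by (simp add: B_def)
  have ind: "independent B"
  proof
    assume "dependent B"
    then obtain g where g: "\<exists>b\<in>B. g b \<noteq> 0" "(\<Sum>b\<in>B. g b *\<^sub>R b) = 0"
      using dependent_finite[OF finB] by auto
    then show False
      using trivial[of "\<lambda>v. g (v, 1)"] inj by (auto simp: B_def sum.reindex)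
  qed
  have "card B = DIM((real ^ 'n) \<times> real)"
    using inj assms(2) by (simp add: B_def card_image)
  then have span: "z \<in> span B" for z
    using card_ge_dim_independent[of B UNIV] ind by auto
  define c where "c = (\<lambda>v z. representation B z (v, 1))"
  have "linear (c v)" for v
    by (rule linearI) (simp_all add: c_def representation_add[OF ind span span] representation_scale[OF ind span])
  moreover have "(\<Sum>v\<in>S. c v z *\<^sub>R (v, 1)) = z" for z
    using sum_representation_eq[OF ind span finB order_refl, of z] inj by (simp add: B_def c_def sum.reindex)
  moreover have "c v (u, 1) = (if v = u then 1 else 0)" if "u \<in> S" for u v
    using representation_basis[OF ind, of "(u, 1)"] that by (auto simp: c_def B_def)
  ultimately show ?thesis
    by (rule that)
qed

text \<open>\<open>c v\<close> is the coordinate at \<open>(v, 1)\<close> with respect to the basis \<open>{(v, 1) | v \<in> S}\<close> of the space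
  that contains the cone over \<open>\<Delta> \<times> {1}\<close>; \<open>snd\<close> is the height in this cone.\<close>

locale simplex_in_polytope =
  fixes \<Delta> S :: "(real ^ 'n::finite) set" and d :: nat and c :: "real ^ 'n \<Rightarrow> (real ^ 'n) \<times> real \<Rightarrow> real"
  assumes convex: "convex \<Delta>"
    and S_subset: "S \<subseteq> \<Delta>"
    and S_lattice: "S \<subseteq> integer_lattice"
    and S_indep: "\<not> affine_dependent S"
    and S_card: "card S = Suc CARD('n)"
    and deg: "lattice_degree \<Delta> = int d"
    and c_linear: "linear (c v)"
    and c_expand: "(\<Sum>v\<in>S. c v z *\<^sub>R (v, 1)) = z"
    and c_basis: "u \<in> S \<Longrightarrow> c v (u, 1) = (if v = u then 1 else 0)"
begin

abbreviation "cone_lattice \<equiv> (integer_lattice :: (real ^ 'n) set) \<times> (\<int> :: real set)"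

lemma finite_S: "finite S"
  using S_indep by (rule aff_independent_finite)

lemmas c_simps = linear_add[OF c_linear] linear_diff[OF c_linear] linear_scale[OF c_linear]
  linear_sum[OF c_linear] linear_neg[OF c_linear] linear_0[OF c_linear]

lemma sum_c: "(\<Sum>v\<in>S. c v z) = snd z"
  using arg_cong[OF c_expand[of z], of snd] by (simp add: snd_sum)

lemma sum_c_fst: "(\<Sum>v\<in>S. c v z *\<^sub>R v) = fst z"
  using arg_cong[OF c_expand[of z], of fst] by (simp add: fst_sum)

lemma c_combination: "v \<in> S \<Longrightarrow> c v (\<Sum>u\<in>S. r u *\<^sub>R (u, 1)) = r v"
  by (simp add: c_simps(3,4) c_basis finite_S if_distrib del: scaleR_Pair cong: if_cong)

lemma cone_lattice_combination:
  "(\<And>u. u \<in> A \<Longrightarrow> r u \<in> \<int>) \<Longrightarrow> A \<subseteq> S \<Longrightarrow> (\<Sum>u\<in>A. r u *\<^sub>R (u, 1)) \<in> cone_lattice"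
  using S_lattice
  by (auto simp: mem_Times_iff fst_sum snd_sum intro!: integer_lattice_sum integer_lattice_scale Ints_sum)

text \<open>Positive coordinates put \<open>q - t *\<^sub>R (w, 1)\<close> in the interior of the
  cone over the simplex. Adding a nonnegative multiple of \<open>(w, 1)\<close> stays interior to
  the cone over \<open>\<Delta>\<close>, so \<open>q\<close> is an interior lattice point at its
  height, which is then at least the codegree.\<close>

lemma interior_height:
  assumes q: "q \<in> cone_lattice" and "t \<ge> 0" "w \<in> \<Delta>"
    and pos: "\<And>v. v \<in> S \<Longrightarrow> c v (q - t *\<^sub>R (w, 1)) > 0"
  shows "real CARD('n) + 1 - real d \<le> snd q"
proof -
  define z where "z = q - t *\<^sub>R (w, 1)"
  define s where "s = snd z"
  have "S \<noteq> {}"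
    using S_card by auto
  then have "s > 0"
    unfolding s_def sum_c[symmetric] using pos finite_S by (intro sum_pos) (auto simp: z_def)
  define h where "h = snd q"
  have h: "h = s + t"
    by (simp add: h_def s_def z_def)
  have "h > 0"
    using h \<open>s > 0\<close> \<open>t \<ge> 0\<close> by simp
  define y where "y = fst z /\<^sub>R s"
  have "y \<in> interior (convex hull S)"
  proof -
    have "(\<Sum>v\<in>S. c v z / s) = 1"
      using \<open>s > 0\<close> sum_c[of z] by (simp add: s_def flip: sum_divide_distrib)
    moreover have "(\<Sum>v\<in>S. (c v z / s) *\<^sub>R v) = y"
      unfolding y_def sum_c_fst[symmetric] by (simp add: scaleR_sum_right divide_inverse_commute)
    moreover have "\<forall>v\<in>S. 0 < c v z / s"
      using pos \<open>s > 0\<close> by (simp add: z_def)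
    ultimately show ?thesis
      using interior_convex_hull_explicit_minimal[OF S_indep] S_card by auto
  qed
  then have y: "y \<in> interior \<Delta>"
    using interior_mono[OF hull_minimal[of S \<Delta> convex]] S_subset convex by blast
  \<comment> \<open>At height 1, \<open>q\<close> becomes a convex combination of \<open>w\<close>
    and the interior point \<open>y\<close>, with positive weight \<open>s / h\<close> on
    \<open>y\<close>.\<close>
  have "w - (s / h) *\<^sub>R (w - y) \<in> interior \<Delta>"
    using \<open>s > 0\<close> \<open>h > 0\<close> \<open>t \<ge> 0\<close> h assms(3) y convex
    by (intro mem_interior_convex_shrink) (auto simp: closure_subset[THEN subsetD])
  moreover have "fst q = h *\<^sub>R (w - (s / h) *\<^sub>R (w - y))"
  proof -
    have "h *\<^sub>R (w - (s / h) *\<^sub>R (w - y)) = (h - s) *\<^sub>R w + s *\<^sub>R y"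
      using \<open>h > 0\<close> by (simp add: scaleR_right_diff_distrib scaleR_left_diff_distrib)
    also have "\<dots> = fst q"
      using \<open>s > 0\<close> h by (simp add: y_def z_def)
    finally show ?thesis ..
  qed
  ultimately have "fst q \<in> interior ((\<lambda>x. h *\<^sub>R x) ` \<Delta>)"
    using \<open>h > 0\<close> interior_injective_linear_image[of "\<lambda>x. h *\<^sub>R x" \<Delta>]
    by (auto simp: inj_def)
  moreover have "h \<in> \<int>" "fst q \<in> integer_lattice"
    using q by (auto simp: h_def)
  moreover obtain k where k: "h = real k"
    using \<open>h \<in> \<int>\<close> \<open>h > 0\<close> by (metis Ints_cases less_imp_le of_int_0_le_iff of_int_of_nat_eq zero_le_imp_eq_int)
  ultimately have "codegree \<Delta> \<le> k"
    unfolding codegree_def by (intro Least_le) auto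
  then show ?thesis
    using deg k by (simp add: lattice_degree_def h_def)
qed

text \<open>Subtracting \<open>z\<close> from the combination with coefficients floor plus one
  leaves a lattice point with coordinates \<open>1 - frac (c v z) > 0\<close>, to which the height
  bound applies with \<open>t = 0\<close>.\<close>

lemma sum_frac_le:
  assumes "z \<in> cone_lattice"
  shows "(\<Sum>v\<in>S. frac (c v z)) \<le> real d"
proof -
  obtain w where w: "w \<in> S"
    using S_card by fastforce
  define q where "q = (\<Sum>v\<in>S. (1 + of_int \<lfloor>c v z\<rfloor>) *\<^sub>R (v, 1)) - z"
  have "q \<in> cone_lattice"
    using assms cone_lattice_combination[of S "\<lambda>v. 1 + of_int \<lfloor>c v z\<rfloor>"]
    by (auto simp: q_def mem_Times_iff intro!: integer_lattice_diff)
  moreover have cq: "c v q = 1 - frac (c v z)" if "v \<in> S" for v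
    using c_combination[OF that] by (simp add: q_def c_simps(2) frac_def)
  ultimately have "real CARD('n) + 1 - real d \<le> snd q"
    using w S_subset by (intro interior_height[of q 0 w]) (auto simp: frac_lt_1)
  also have "\<dots> = real (card S) - (\<Sum>v\<in>S. frac (c v z))"
    by (simp add: sum_c[symmetric] cq sum_subtractf)
  finally show ?thesis
    using S_card by simp
qed

text \<open>The fractional parts of \<open>x\<close> and \<open>- x\<close> add up to 1 if
  \<open>x\<close> is not an integer and to 0 otherwise, so the bound for \<open>z\<close> and
  \<open>- z\<close> counts the non-integral coordinates.\<close>

lemma card_nonintegral_le:
  assumes "z \<in> cone_lattice"
  shows "card {v \<in> S. c v z \<notin> \<int>} \<le> 2 * d"
proof -
  have neg: "- z \<in> cone_lattice"
    using assms by (auto simp: mem_Times_iff integer_lattice_def)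
  have "real (card {v \<in> S. c v z \<notin> \<int>}) = (\<Sum>v\<in>S. frac (c v z) + frac (c v (- z)))"
  proof -
    have "frac (c v z) + frac (c v (- z)) = (if c v z \<notin> \<int> then 1 else 0)" for v
      by (simp add: c_simps(5) frac_neg frac_eq_0_iff)
    then show ?thesis
      using finite_S by (simp add: sum.If_cases Int_def)
  qed
  also have "\<dots> \<le> real d + real d"
    unfolding sum.distrib using sum_frac_le[OF assms] sum_frac_le[OF neg] by (rule add_mono)
  finally show ?thesis
    by simp
qed

text \<open>For each such coordinate \<open>v\<close> fix a witness \<open>z v\<close>. Adding
  \<open>z u\<close> to a subset sum shifts coordinate \<open>u\<close> by a non-integer, so the
  coordinate is non-integral before or after, as the averaging argument requires.\<close>

lemma card_nonintegral_coordinates_le: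
  "card {v \<in> S. \<exists>z\<in>cone_lattice. c v z \<notin> \<int>} \<le> 4 * d"
proof -
  define U where "U = {v \<in> S. \<exists>z\<in>cone_lattice. c v z \<notin> \<int>}"
  have "\<forall>v\<in>U. \<exists>z. z \<in> cone_lattice \<and> c v z \<notin> \<int>"
    by (auto simp: U_def)
  then obtain z where z: "\<And>v. v \<in> U \<Longrightarrow> z v \<in> cone_lattice" "\<And>v. v \<in> U \<Longrightarrow> c v (z v) \<notin> \<int>"
    by metis
  have "finite U"
    using finite_S by (simp add: U_def)
  define h where "h = (\<lambda>T. {v \<in> S. c v (sum z T) \<notin> \<int>})"
  have "card U \<le> 2 * (2 * d)"
  proof (rule half_of_subsets_bound[where h = h])
    fix u T
    assume u: "u \<in> U" and T: "T \<subseteq> U - {u}"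
    have "u \<in> S"
      using u by (simp add: U_def)
    have "finite T"
      using T \<open>finite U\<close> finite_subset by blast
    then have "c u (sum z (insert u T)) = c u (z u) + c u (sum z T)"
      using T by (subst sum.insert) (auto simp: c_simps(1))
    then show "u \<in> h T \<or> u \<in> h (insert u T)"
      using z(2)[OF u] \<open>u \<in> S\<close> Ints_diff[of "c u (sum z (insert u T))" "c u (sum z T)"]
      by (auto simp: h_def)
  next
    fix T
    assume "T \<subseteq> U"
    then have "sum z T \<in> cone_lattice"
      using z(1) by (force simp: mem_Times_iff fst_sum snd_sum intro!: integer_lattice_sum Ints_sum)
    then have "card (h T) \<le> 2 * d"
      unfolding h_def by (rule card_nonintegral_le)
    moreover have "card (h T \<inter> U) \<le> card (h T)"
      using finite_S by (intro card_mono) (auto simp: h_def)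
    ultimately show "card (h T \<inter> U) \<le> 2 * d"
      by simp
  qed fact
  then show ?thesis
    by (simp add: U_def)
qed

text \<open>The relation between \<open>w\<close> and \<open>S\<close> is a circuit. The sum of the points on one side of
  its Radon partition is interior to the cone over the circuit, and adding the vertices with
  coefficient zero makes it interior to the cone over \<open>\<Delta>\<close>.\<close>

lemma
  assumes w: "w \<in> \<Delta>" "w \<in> integer_lattice"
  shows card_positive_le: "card {v \<in> S. c v (w, 1) > 0} \<le> d + 1"
    and card_negative_le: "card {v \<in> S. c v (w, 1) < 0} \<le> d"
proof -
  obtain e where e: "e > 0" "e < 1" "\<And>v. v \<in> S \<Longrightarrow> e * \<bar>c v (w, 1)\<bar> < 1"
    using ex_small_epsilon[OF finite_S, of "\<lambda>v. c v (w, 1)"] by auto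
  have e': "- 1 < e * c v (w, 1)" "e * c v (w, 1) < 1" if "v \<in> S" for v
    using e(3)[OF that] e(1) by (auto simp: abs_if split: if_splits) (smt (verit) mult_pos_neg mult_nonneg_nonneg)+
  have indicator: "c v (\<Sum>u\<in>A. (u, 1)) = (if v \<in> A then 1 else 0)" if "A \<subseteq> S" for A v
  proof -
    have "c v (\<Sum>u\<in>A. (u, 1)) = (\<Sum>u\<in>A. if v = u then 1 else 0)"
      unfolding c_simps(4) using that by (intro sum.cong) (auto simp: c_basis)
    then show ?thesis
      using finite_subset[OF that finite_S] by simp
  qed
  have lat: "(\<Sum>u\<in>A. (u, 1)) \<in> cone_lattice" if "A \<subseteq> S" for A
    using cone_lattice_combination[of A "\<lambda>_. 1"] that by simp
  have height: "snd (\<Sum>u\<in>S - A. (u, 1::real)) = real CARD('n) + 1 - real (card A)" if "A \<subseteq> S" for A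
    using card_mono[OF finite_S that] finite_subset[OF that finite_S] that S_card
    by (simp add: snd_sum card_Diff_subset of_nat_diff)

  define P where "P = {v \<in> S. c v (w, 1) > 0}"
  \<comment> \<open>The point \<open>w\<close> replaces the points of \<open>P\<close>. After the
    subtraction the coordinates are \<open>e * c v (w, 1)\<close> on \<open>P\<close> and
    \<open>1 + e * c v (w, 1)\<close> elsewhere. The summand \<open>(w, 1)\<close> raises the height
    by 1, whence \<open>d + 1\<close>.\<close>
  define q where "q = (w, 1) + (\<Sum>u\<in>S - P. (u, 1::real))"
  have "c v (q - (1 - e) *\<^sub>R (w, 1)) > 0" if "v \<in> S" for v
  proof -
    have "q - (1 - e) *\<^sub>R (w, 1) = e *\<^sub>R (w, 1) + (\<Sum>u\<in>S - P. (u, 1::real))"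
      by (simp add: q_def algebra_simps)
    then have "c v (q - (1 - e) *\<^sub>R (w, 1)) = e * c v (w, 1) + (if v \<in> S - P then 1 else 0)"
      using indicator[of "S - P" v] by (simp only: c_simps) simp
    then show ?thesis
      using that e(1) e'[OF that] by (auto simp: P_def)
  qed
  moreover have "q \<in> cone_lattice"
    using lat[of "S - P"] w(2) by (auto simp: q_def mem_Times_iff intro!: integer_lattice_add)
  ultimately have "real CARD('n) + 1 - real d \<le> snd q"
    using e w(1) by (intro interior_height[of q "1 - e" w]) auto
  then have "card P \<le> d + 1"
    using height[of P] by (simp add: q_def P_def)
  then show "card {v \<in> S. c v (w, 1) > 0} \<le> d + 1"
    by (simp add: P_def)

  define N where "N = {v \<in> S. c v (w, 1) < 0}"
  \<comment> \<open>Now the coordinates after the subtraction are \<open>- e * c v (w, 1)\<close> on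
    \<open>N\<close> and \<open>1 - e * c v (w, 1)\<close> elsewhere.\<close>
  define q' where "q' = (\<Sum>u\<in>S - N. (u, 1::real))"
  have "c v (q' - e *\<^sub>R (w, 1)) > 0" if "v \<in> S" for v
  proof -
    have "c v (q' - e *\<^sub>R (w, 1)) = (if v \<in> S - N then 1 else 0) - e * c v (w, 1)"
      using indicator[of "S - N" v] by (simp only: c_simps q'_def) simp
    then show ?thesis
      using that e(1) e'[OF that] by (auto simp: N_def mult_pos_neg)
  qed
  moreover have "q' \<in> cone_lattice"
    using lat[of "S - N"] by (simp add: q'_def)
  ultimately have "real CARD('n) + 1 - real d \<le> snd q'"
    using e w(1) by (intro interior_height[of q' e w]) auto
  then have "card N \<le> d"
    using height[of N] by (simp add: q'_def N_def)
  then show "card {v \<in> S. c v (w, 1) < 0} \<le> d"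
    by (simp add: N_def)
qed

lemma card_support_le:
  assumes "w \<in> \<Delta>" "w \<in> integer_lattice"
  shows "card {v \<in> S. c v (w, 1) \<noteq> 0} \<le> 2 * d + 1"
proof -
  have "{v \<in> S. c v (w, 1) \<noteq> 0} = {v \<in> S. c v (w, 1) > 0} \<union> {v \<in> S. c v (w, 1) < 0}"
    by auto
  then show ?thesis
    using card_positive_le[OF assms] card_negative_le[OF assms]
      card_Un_le[of "{v \<in> S. c v (w, 1) > 0}" "{v \<in> S. c v (w, 1) < 0}"] by simp
qed

text \<open>Treats the case in which the bound on the dimension is vacuous: the support has one
  element, and its coefficient is 1 since the coordinates sum to 1.\<close>

lemma degree_zero_vertices:
  assumes "d = 0" "w \<in> \<Delta>" "w \<in> integer_lattice"
  shows "w \<in> S"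
proof -
  have sum: "(\<Sum>v\<in>S. c v (w, 1)) = 1"
    by (simp add: sum_c)
  then obtain u where u: "u \<in> S" "c u (w, 1) \<noteq> 0"
    by (metis sum.neutral zero_neq_one)
  have "{v \<in> S. c v (w, 1) \<noteq> 0} = {u}"
    using card_support_le[OF assms(2,3)] assms(1) u finite_S
    by (intro card_seteq[symmetric]) auto
  then have other: "c v (w, 1) = 0" if "v \<in> S - {u}" for v
    using that by auto
  then have "c u (w, 1) = 1"
    using sum u(1) finite_S by (simp add: sum.remove[of S u])
  then have "w = u"
    using sum_c_fst[of "(w, 1)"] other u(1) finite_S by (simp add: sum.remove[of S u])
  then show ?thesis
    using u(1) by simp
qed

text \<open>A union bound: non-integrality excludes at most \<open>4 * d\<close> of the
  \<open>CARD('n) + 1\<close> coordinates, and each point of \<open>W\<close> at most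
  \<open>2 * d + 1\<close>.\<close>

lemma apex_exists:
  assumes W: "finite W" "W \<subseteq> \<Delta>" "W \<subseteq> integer_lattice"
    and large: "4 * d + (2 * d + 1) * card W \<le> CARD('n)"
  obtains v where "v \<in> S" "\<And>z. z \<in> cone_lattice \<Longrightarrow> c v z \<in> \<int>" "\<And>w. w \<in> W \<Longrightarrow> c v (w, 1) = 0"
proof -
  let ?U = "{v \<in> S. \<exists>z\<in>cone_lattice. c v z \<notin> \<int>}"
  let ?X = "\<Union>w\<in>W. {v \<in> S. c v (w, 1) \<noteq> 0}"
  have "card ?X \<le> (\<Sum>w\<in>W. card {v \<in> S. c v (w, 1) \<noteq> 0})"
    by (rule card_UN_le[OF W(1)])
  also have "\<dots> \<le> (\<Sum>w\<in>W. 2 * d + 1)"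
    using W by (intro sum_mono card_support_le) auto
  finally have "card (?U \<union> ?X) \<le> 4 * d + (2 * d + 1) * card W"
    using card_nonintegral_coordinates_le card_Un_le[of ?U ?X] by (simp add: mult.commute)
  then have "card (?U \<union> ?X) < card S"
    using large S_card by simp
  then have "\<not> S \<subseteq> ?U \<union> ?X"
    using finite_S W(1) card_mono[of "?U \<union> ?X" S] by auto
  then obtain v where "v \<in> S" "v \<notin> ?U \<union> ?X"
    by blast
  then show ?thesis
    using that by blast
qed

end

section \<open>From the binomial bound to a bound linear in the number of extra vertices\<close>

lemma binomial_ge_Suc_mult: "a * b + 1 \<le> (a + b) choose a"
proof (induction b)
  case (Suc b)
  show ?case
  proof (cases a)
    case (Suc a')
    \<comment> \<open>This is the term that Pascal's rule adds when \<open>b\<close> grows by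
      1.\<close>
    have "a \<le> (a + b) choose a'"
      using binomial_right_mono[of a "a + b" a'] Suc by simp
    then show ?thesis
      using Suc.IH Suc by simp
  qed simp
qed simp

text \<open>For \<open>d > 0\<close> the binomial coefficient is at least
  \<open>2 * d * m + 1\<close>, so \<open>n\<close> is at least
  \<open>4 * d + 8 * d * d * m\<close>, and \<open>8 * d * d\<close> is at least
  \<open>2 * d + 1\<close>.\<close>

lemma dimension_bound:
  fixes V d m n :: nat
  assumes "m + 1 \<le> V" "4 * d * ((2 * d + V - 1) choose (2 * d)) \<le> n" "d = 0 \<Longrightarrow> m = 0"
  shows "4 * d + (2 * d + 1) * m \<le> n"
proof (cases "d = 0")
  case False
  have "2 * d * m + 1 \<le> (2 * d + m) choose (2 * d)"
    by (rule binomial_ge_Suc_mult)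
  also have "\<dots> \<le> (2 * d + V - 1) choose (2 * d)"
    using assms(1) by (intro binomial_right_mono) auto
  finally have "4 * d * (2 * d * m + 1) \<le> n"
    using assms(2) by (meson le_trans mult_le_mono2)
  moreover have "2 * d + 1 \<le> 8 * d * d"
    using False by (cases d) auto
  then have "(2 * d + 1) * m \<le> 8 * d * d * m"
    by (rule mult_le_mono1)
  ultimately show ?thesis
    by (simp add: algebra_simps)
qed (use assms(3) in auto)

subsection \<open>Pyramids\<close>

text \<open>The values 0 at \<open>u\<close> and 1 at \<open>v\<close> show that \<open>a\<close> is
  primitive, hence a row of a unimodular matrix. In the new coordinates the affine function
  \<open>a \<bullet> x + b\<close> is the coordinate \<open>l\<close>, so all points but
  \<open>v\<close> land in the hyperplane.\<close>

lemma pyramid_from_apex: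
  fixes E :: "(real ^ 'n::finite) set" and l :: 'n
  assumes fin: "finite E" and lat: "E \<subseteq> integer_lattice" and dim: "aff_dim E = int CARD('n)"
    and v: "v \<in> E" and "u \<in> E" "u \<noteq> v"
    and a: "a \<in> integer_lattice"
    and apex: "a \<bullet> v + b = 1" and base: "\<And>w. w \<in> E - {v} \<Longrightarrow> a \<bullet> w + b = 0"
  shows "\<exists>\<Delta>'. \<Delta>' \<subseteq> coordinate_hyperplane l \<and> lattice_polytope \<Delta>' \<and>
    aff_dim \<Delta>' = int CARD('n) - 1 \<and> AGL_equivalent (convex hull E) (standard_pyramid l \<Delta>')"
proof -
  have "a \<bullet> (v - u) = 1"
    using base[of u] apex assms(5,6) by (simp add: inner_diff_right)
  moreover have "v - u \<in> integer_lattice"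
    using lat v assms(5) by (auto intro: integer_lattice_diff)
  ultimately obtain B where B: "B \<in> GL_int" "B *v axis l 1 = a"
    using primitive_vector_in_GL_int_orbit[OF a] by blast
  define A where "A = transpose B"
  have A: "A \<in> GL_int"
    using B(1) by (simp add: A_def GL_int_transpose)
  have Al: "(A *v x) $ l = a \<bullet> x" for x
  proof -
    have "(A *v x) $ l = axis l 1 \<bullet> (A *v x)"
      by (simp add: inner_axis')
    also have "\<dots> = (B *v axis l 1) \<bullet> x"
      by (metis A_def dot_lmul_matrix transpose_matrix_vector transpose_transpose)
    finally show ?thesis
      by (simp add: B(2))
  qed
  \<comment> \<open>This translation sends \<open>v\<close> to the apex. As
    \<open>a \<bullet> v + b = 1\<close>, the constant term of coordinate \<open>l\<close> becomes
    \<open>b\<close>.\<close>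
  define t where "t = axis l 1 - A *v v"
  define f where "f = (\<lambda>x. A *v x + t)"
  have int_A: "A *v x \<in> integer_lattice" if "x \<in> integer_lattice" for x
    using A that by (simp add: GL_int_iff int_matrix_vector_mult)
  then have t: "t \<in> integer_lattice"
    using lat v by (auto simp: t_def intro!: integer_lattice_diff integer_lattice_axis)
  have fl: "f x $ l = a \<bullet> x + b" for x
    using apex by (simp add: f_def t_def Al)
  have fv: "f v = axis l 1"
    by (simp add: f_def t_def)
  define Q where "Q = convex hull (f ` (E - {v}))"
  obtain B' where "B' ** A = mat 1"
    using GL_int_inverse[OF A] by blast
  then have "inj ((*v) A)"
    by (metis (no_types, lifting) injI matrix_vector_mul_assoc matrix_vector_mul_lid)
  have fE: "f ` E = (+) t ` ((*v) A ` E)" for E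
    by (auto simp: f_def image_iff)
  have "aff_dim (f ` E) = aff_dim E"
    unfolding fE by (simp add: aff_dim_translation_eq aff_dim_injective_linear_image \<open>inj ((*v) A)\<close>)
  moreover have fE_insert: "f ` E = insert (axis l 1) (f ` (E - {v}))"
    using v fv by (metis image_insert insert_Diff)
  ultimately have dim_insert: "aff_dim (insert (axis l 1) (f ` (E - {v}))) = int CARD('n)"
    using dim by simp
  have affine_plane: "affine (coordinate_hyperplane l)"
  proof -
    have "coordinate_hyperplane l = {x. axis l 1 \<bullet> x = 0}"
      by (auto simp: coordinate_hyperplane_def inner_axis')
    then show ?thesis
      by (metis affine_hyperplane)
  qed
  have fE_plane: "f ` (E - {v}) \<subseteq> coordinate_hyperplane l"
    using base by (auto simp: coordinate_hyperplane_def fl)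
  have Q_plane: "Q \<subseteq> coordinate_hyperplane l"
    unfolding Q_def using fE_plane affine_plane by (intro hull_minimal affine_imp_convex)
  have "affine hull (f ` (E - {v})) \<subseteq> coordinate_hyperplane l"
    using fE_plane affine_plane by (intro hull_minimal)
  then have "axis l 1 \<notin> affine hull (f ` (E - {v}))"
    by (auto simp: coordinate_hyperplane_def)
  \<comment> \<open>The apex lies off the affine hull of the base, so removing it lowers the
    dimension by exactly one.\<close>
  then have "aff_dim Q = int CARD('n) - 1"
    using dim_insert by (simp add: Q_def aff_dim_convex_hull aff_dim_insert)
  moreover have "lattice_polytope Q"
  proof -
    have "polytope Q"
      unfolding Q_def using fin by (intro polytope_convex_hull) auto
    moreover have "f ` (E - {v}) \<subseteq> integer_lattice"
      using lat t int_A by (auto simp: f_def intro!: integer_lattice_add)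
    ultimately show ?thesis
      unfolding lattice_polytope_def Q_def using extreme_point_of_convex_hull by blast
  qed
  moreover have "AGL_equivalent (convex hull E) (standard_pyramid l Q)"
  proof -
    have "f ` (convex hull E) = convex hull (f ` E)"
      unfolding fE by (simp add: convex_hull_translation convex_hull_linear_image)
    also have "\<dots> = convex hull (insert (axis l 1) Q)"
      unfolding Q_def fE_insert by (rule hull_insert)
    finally have "f ` (convex hull E) = standard_pyramid l Q"
      by (simp add: standard_pyramid_def)
    moreover have "f \<in> AGL_int"
      unfolding AGL_int_def f_def using A t by blast
    ultimately show ?thesis
      unfolding AGL_equivalent_def by blast
  qed
  ultimately show ?thesis
    using Q_plane by blast
qed

theorem theorem1p3:
  fixes V d :: nat and l :: "'n::finite" and \<Delta> :: "(real ^ 'n) set"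
  assumes "V \<ge> 1"
    and "CARD('n) \<ge> 4 * d * ((2 * d + V - 1) choose (2 * d))"
    and "lattice_polytope \<Delta>"
    and "aff_dim \<Delta> = int CARD('n)"
    and "normalized_volume \<Delta> = real V"
    and "lattice_degree \<Delta> = int d"
  shows "\<exists>\<Delta>'. \<Delta>' \<subseteq> coordinate_hyperplane l \<and> lattice_polytope \<Delta>' \<and>
           aff_dim \<Delta>' = int CARD('n) - 1 \<and>
           AGL_equivalent \<Delta> (standard_pyramid l \<Delta>')"
proof -
  define E where "E = {v. v extreme_point_of \<Delta>}"
  have polytope: "polytope \<Delta>"
    using assms(3) by (simp add: lattice_polytope_def)
  have fin: "finite E"
    unfolding E_def using polytope by (simp add: finite_polyhedron_extreme_points polytope_imp_polyhedron)
  have hull: "\<Delta> = convex hull E"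
    unfolding E_def using polytope by (intro Krein_Milman_Minkowski) (auto simp: polytope_imp_compact polytope_imp_convex)
  have lat: "E \<subseteq> integer_lattice"
    using assms(3) by (auto simp: E_def lattice_polytope_def)
  have dimE: "aff_dim E = int CARD('n)"
    using assms(4) by (simp add: hull aff_dim_convex_hull)
  \<comment> \<open>Removing an extreme point leaves a convex set, which contains the hull of the
    other vertices.\<close>
  have position: "w \<notin> convex hull (E - {w})" if "w \<in> E" for w
  proof -
    have "convex hull (E - {w}) \<subseteq> \<Delta> - {w}"
    proof (rule hull_minimal)
      show "E - {w} \<subseteq> \<Delta> - {w}"
        using hull_subset[of E convex] hull by auto
      show "convex (\<Delta> - {w})"
        using that polytope_imp_convex[OF polytope] by (simp add: E_def extreme_point_of_stillconvex)
    qed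
    then show ?thesis
      by blast
  qed
  obtain S where S: "S \<subseteq> E" "\<not> affine_dependent S" "affine hull E = affine hull S"
    using affine_basis_exists by blast
  then have cardS: "card S = Suc CARD('n)"
    using aff_dim_unique[of S E] dimE by simp
  define W where "W = E - S"
  have SW: "S \<union> W = E"
    using S(1) by (auto simp: W_def)
  have "(real (card W) + 1) / fact CARD('n) \<le> measure lebesgue (convex hull (S \<union> W))"
  proof (rule convex_position_volume[OF S(2) cardS])
    show "w \<notin> convex hull (S \<union> W - {w})" if "w \<in> W" for w
      using position[of w] that by (simp add: SW) (simp add: W_def)
  qed (use S(1) lat fin in \<open>auto simp: W_def\<close>)
  then have "real (card W) + 1 \<le> real V"
    using assms(5) by (simp add: SW hull[symmetric] normalized_volume_def field_simps)
  then have cardW: "card W + 1 \<le> V"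
    by linarith
  obtain c :: "real ^ 'n \<Rightarrow> (real ^ 'n) \<times> real \<Rightarrow> real" where c: "\<And>v. linear (c v)"
    "\<And>z. (\<Sum>v\<in>S. c v z *\<^sub>R (v, 1)) = z" "\<And>u v. u \<in> S \<Longrightarrow> c v (u, 1) = (if v = u then 1 else 0)"
    by (rule affine_coordinates_exist[OF S(2) cardS]) (rule that)
  have E_\<Delta>: "E \<subseteq> \<Delta>"
    unfolding hull by (rule hull_subset)
  interpret simplex_in_polytope \<Delta> S d c
    by (intro simplex_in_polytope.intro c)
       (use S lat E_\<Delta> cardS assms(6) polytope in \<open>auto simp: polytope_imp_convex\<close>)
  have "card W = 0" if "d = 0"
    using degree_zero_vertices[OF that] E_\<Delta> lat fin by (auto simp: W_def)
  then have "4 * d + (2 * d + 1) * card W \<le> CARD('n)"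
    using dimension_bound[OF cardW assms(2)] by blast
  then obtain v where v: "v \<in> S" "\<And>z. z \<in> cone_lattice \<Longrightarrow> c v z \<in> \<int>" "\<And>w. w \<in> W \<Longrightarrow> c v (w, 1) = 0"
    using apex_exists[of W] fin E_\<Delta> lat by (metis W_def Diff_subset finite_Diff subset_trans)
  \<comment> \<open>The linear part of \<open>c v\<close> restricted to height 1; integrality of
    \<open>c v\<close> at the lattice points \<open>(axis i 1, 0)\<close> makes it integral.\<close>
  define a where "a = (\<chi> i. c v (axis i 1, 0))"
  have cv: "c v (x, 1) = a \<bullet> x + c v (0, 1)" for x
  proof -
    have "(x, 1) = (\<Sum>i\<in>UNIV. x $ i *\<^sub>R (axis i 1, 0)) + (0, 1)"
      by (simp add: prod_eq_iff fst_sum snd_sum vec_eq_iff axis_def if_distrib cong: if_cong)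
    then have "c v (x, 1) = c v ((\<Sum>i\<in>UNIV. x $ i *\<^sub>R (axis i 1, 0)) + (0, 1))"
      by (rule arg_cong)
    also have "\<dots> = (\<Sum>i\<in>UNIV. x $ i * c v (axis i 1, 0)) + c v (0, 1)"
      by (simp only: linear_add[OF c_linear] linear_sum[OF c_linear] linear_scale[OF c_linear] real_scaleR_def)
    finally show ?thesis
      by (simp add: a_def inner_vec_def mult.commute)
  qed
  have "a \<in> integer_lattice"
    using v(2) by (auto simp: a_def integer_lattice_axis)
  moreover have "a \<bullet> v + c v (0, 1) = 1"
    using c(3)[OF v(1), of v] cv[of v] by simp
  moreover have "a \<bullet> w + c v (0, 1) = 0" if "w \<in> E - {v}" for w
    using that v(3)[of w] c(3)[of w v] cv[of w] by (cases "w \<in> S") (auto simp: W_def)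
  \<comment> \<open>A second point of \<open>S\<close> exists because \<open>CARD('n)\<close> is at
    least 1.\<close>
  moreover obtain u where "u \<in> S" "u \<noteq> v"
  proof -
    have "card (S - {v}) > 0"
      using cardS v(1) finite_S by simp
    then show ?thesis
      using that by (auto simp: card_gt_0_iff)
  qed
  ultimately show ?thesis
    using pyramid_from_apex[OF fin lat dimE, of v u a "c v (0, 1)" l] v(1) S(1) by (auto simp: hull)
qed

end
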